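(* Let $T$ be a continuous t-norm. The following statements are equivalent. (i) $T$ is power stable, i.e. $(T(u,v))_T^{(t)}=T(u_T^{(t)},v_T^{(t)})$ for all $(u,v)\in[0,1]^2$ and all $t\in(0,+\infty)$. (ii) Every $u\in[0,1]$ is power stable, i.e. for every $u\in[0,1]$ and all $t_1,t_2\in(0,+\infty)$, $(u_T^{(t_1)})_T^{(t_2)}=u_T^{(t_1t_2)}$. (iii) One of the following holds: (iii-1) $T=T_{\mathbf M}$, where $T_{\mathbf M}(u,v)=\min\{u,v\}$; (iii-2) $T$ is a strict t-norm; (iii-3) $T$ is an ordinal sum of strict t-norms, i.e. there exist a (finite or countably infinite) index set $\mathscr A$, a family of strict t-norms $\{T_\lambda\}_{\lambda\in\mathscr A}$, and a family of pairwise disjoint open subintervals $\{(a_\lambda,e_\lambda)\}_{\lambda\in\mathscr A}$ of $[0,1]$ such that $$T(u,v)=\begin{cases}a_\lambda+(e_\lambda-a_\lambda)\,T_\lambda\left(\frac{u-a_\lambda}{e_\lambda-a_\lambda},\frac{v-a_\lambda}{e_\lambda-a_\lambda}\right), & (u,v)\in[a_\lambda,e_\lambda]^2,\\ \min\{u,v\}, & \text{otherwise.}\end{cases}$$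
   Context: A t-norm is a map $T:[0,1]^2\to[0,1]$ that is commutative, associative, nondecreasing in each argument, and satisfies $T(x,1)=x$. A continuous t-norm is strict if $T(x,y)<T(x,z)$ whenever $x>0$ and $y<z$. The intervals $(a_\lambda,e_\lambda)$ are non-empty ($a_\lambda<e_\lambda$). Powers: $\mathbb N=\{1,2,\dots\}$. For $x\in[0,1]$ put $x_T^{(0)}=1$, $x_T^{(1)}=x$, $x_T^{(n)}=T(x_T^{(n-1)},x)$. For $T$ continuous, $u\in[0,1]$, $p,q\in\mathbb N$: $u_T^{(1/p)}=\sup\{v\in[0,1]\mid v_T^{(p)}<u\}$ (with $\sup\varnothing=0$) and $u_T^{(q/p)}=(u_T^{(1/p)})_T^{(q)}$ (this is independent of the representation of the fraction). For real $t>0$: $u_T^{(t)}=\inf\{u_T^{(r)}\mid r\in[0,t]\cap\mathbb Q\}$, which agrees with the preceding definition for rational $t>0$. *)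

theory Defs
  imports "HOL-Analysis.Analysis"
begin

text \<open>
  Operations on the unit interval are represented by total functions on the reals; only their
  values on \<open>{0..1}\<close> matter, and every condition below is relativised to that interval.
\<close>

definition is_tnorm :: "(real \<Rightarrow> real \<Rightarrow> real) \<Rightarrow> bool" where
  "is_tnorm T \<longleftrightarrow>
     (\<forall>x\<in>{0..1}. \<forall>y\<in>{0..1}. T x y \<in> {0..1}) \<and>
     (\<forall>x\<in>{0..1}. \<forall>y\<in>{0..1}. T x y = T y x) \<and>
     (\<forall>x\<in>{0..1}. \<forall>y\<in>{0..1}. \<forall>z\<in>{0..1}. T (T x y) z = T x (T y z)) \<and>
     (\<forall>x\<in>{0..1}. \<forall>y\<in>{0..1}. \<forall>z\<in>{0..1}. y \<le> z \<longrightarrow> T x y \<le> T x z \<and> T y x \<le> T z x) \<and>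
     (\<forall>x\<in>{0..1}. T x 1 = x)"

definition continuous_tnorm :: "(real \<Rightarrow> real \<Rightarrow> real) \<Rightarrow> bool" where
  "continuous_tnorm T \<longleftrightarrow>
     is_tnorm T \<and> continuous_on ({0..1} \<times> {0..1}) (\<lambda>(x, y). T x y)"

definition strict_tnorm :: "(real \<Rightarrow> real \<Rightarrow> real) \<Rightarrow> bool" where
  "strict_tnorm T \<longleftrightarrow>
     continuous_tnorm T \<and>
     (\<forall>x\<in>{0..1}. \<forall>y\<in>{0..1}. \<forall>z\<in>{0..1}. x > 0 \<and> y < z \<longrightarrow> T x y < T x z)"

fun tpow_nat :: "(real \<Rightarrow> real \<Rightarrow> real) \<Rightarrow> real \<Rightarrow> nat \<Rightarrow> real" where
  "tpow_nat T x 0 = 1"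
| "tpow_nat T x (Suc 0) = x"
| "tpow_nat T x (Suc (Suc n)) = T (tpow_nat T x (Suc n)) x"

text \<open>The supremum of the empty set is \<open>0\<close> by convention; it is unspecified for \<open>Sup\<close> on reals.\<close>

definition troot :: "(real \<Rightarrow> real \<Rightarrow> real) \<Rightarrow> real \<Rightarrow> nat \<Rightarrow> real" where
  "troot T u p =
     (let S = {v \<in> {0..1}. tpow_nat T v p < u} in if S = {} then 0 else Sup S)"

text \<open>The power with exponent \<open>q / p\<close>; the arguments are the numerator and the denominator.\<close>

definition tpow_frac :: "(real \<Rightarrow> real \<Rightarrow> real) \<Rightarrow> real \<Rightarrow> nat \<Rightarrow> nat \<Rightarrow> real" where
  "tpow_frac T u q p = tpow_nat T (troot T u p) q"

text \<open>
  The infimum of the powers over all rational exponents in \<open>[0, t]\<close>. For a continuous t-norm a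
  power with rational exponent does not depend on the fraction representing the exponent, so the
  set is indexed by all fractions \<open>q / p\<close> in \<open>[0, t]\<close>; numerator \<open>0\<close> yields the zeroth power \<open>1\<close>.
\<close>

definition tpow :: "(real \<Rightarrow> real \<Rightarrow> real) \<Rightarrow> real \<Rightarrow> real \<Rightarrow> real" where
  "tpow T u t = Inf {tpow_frac T u q p | q p. p \<ge> 1 \<and> real q / real p \<le> t}"

definition power_stable :: "(real \<Rightarrow> real \<Rightarrow> real) \<Rightarrow> bool" where
  "power_stable T \<longleftrightarrow>
     (\<forall>u\<in>{0..1}. \<forall>v\<in>{0..1}. \<forall>t>0. tpow T (T u v) t = T (tpow T u t) (tpow T v t))"

definition power_stable_element :: "(real \<Rightarrow> real \<Rightarrow> real) \<Rightarrow> real \<Rightarrow> bool" where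
  "power_stable_element T u \<longleftrightarrow>
     (\<forall>t1>0. \<forall>t2>0. tpow T (tpow T u t1) t2 = tpow T u (t1 * t2))"

text \<open>
  The index set is finite or countably infinite, hence without loss of generality a set of
  natural numbers. Distinct closed intervals may share an end point \<open>c\<close>; both clauses
  then give the value \<open>c\<close> at \<open>(c, c)\<close>.
\<close>

definition ordinal_sum_of_strict :: "(real \<Rightarrow> real \<Rightarrow> real) \<Rightarrow> bool" where
  "ordinal_sum_of_strict T \<longleftrightarrow>
     (\<exists>(A :: nat set) (S :: nat \<Rightarrow> real \<Rightarrow> real \<Rightarrow> real) (a :: nat \<Rightarrow> real) (e :: nat \<Rightarrow> real).
        (\<forall>i\<in>A. strict_tnorm (S i)) \<and>
        (\<forall>i\<in>A. 0 \<le> a i \<and> a i < e i \<and> e i \<le> 1) \<and>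
        disjoint_family_on (\<lambda>i. {a i<..<e i}) A \<and>
        (\<forall>u\<in>{0..1}. \<forall>v\<in>{0..1}.
           (\<forall>i\<in>A. u \<in> {a i..e i} \<and> v \<in> {a i..e i} \<longrightarrow>
              T u v = a i + (e i - a i) * S i ((u - a i) / (e i - a i)) ((v - a i) / (e i - a i))) \<and>
           ((\<nexists>i. i \<in> A \<and> u \<in> {a i..e i} \<and> v \<in> {a i..e i}) \<longrightarrow> T u v = min u v)))"

end

theory Submission imports Defs begin

text \<open>
  All three statements are equivalent to a fourth one: squaring \<open>x \<mapsto> T x x\<close> is injective on the
  unit interval. This hypothesis is the locale \<open>square_injective_t_norm\<close>.

  Each kind of power stability implies it, because it gives
  \<open>(x\<^sup>2)\<^sup>1\<^sup>/\<^sup>2 = x\<close>: from (i), \<open>T(x, x)\<^sup>1\<^sup>/\<^sup>2 = T(x\<^sup>1\<^sup>/\<^sup>2, x\<^sup>1\<^sup>/\<^sup>2) = x\<close>, and from (ii),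
  \<open>(x\<^sup>2)\<^sup>1\<^sup>/\<^sup>2 = x\<^sup>1\<close>. So squaring has a left inverse.

  Conversely, if squaring is injective then so is every power \<open>x \<mapsto> x\<^sup>n\<close> with \<open>n \<ge> 1\<close>
  (\<open>pow_injective\<close>). The power with exponent \<open>1 / p\<close> is its genuine inverse, so it commutes with
  \<open>T\<close> and with the other powers, which settles both kinds of stability for rational exponents.
  Real exponents follow by passing to the limit along the increasing fractions
  \<open>\<lfloor>t n!\<rfloor> / n!\<close>, which are cofinal among the fractions in \<open>[0, t]\<close> (\<open>rpow_limit\<close>). For (i) the
  continuity of \<open>T\<close> suffices. For (ii) the limit of \<open>u\<^sup>s\<close> as \<open>s\<close> increases to \<open>t\<close> has to be
  \<open>u\<^sup>t\<close>, also when \<open>t\<close> is rational (\<open>rpow_left_continuous\<close>). This holds because the roots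
  \<open>u\<^sup>1\<^sup>/\<^sup>k\<close> increase to an idempotent element, which acts as a unit on all smaller elements.

  As for (iii), squaring is visibly strictly increasing for the minimum, for a strict t-norm
  and for an ordinal sum of strict ones. Conversely, the idempotent elements form a compact set,
  on the complement of which the t-norm splits into summands living on the gaps; off the squares
  of the gaps \<open>T\<close> is the minimum because an idempotent element \<open>e\<close> satisfies
  \<open>T x e = min x e\<close>. On a gap \<open>(a, e)\<close> a failure of cancellation \<open>T u v = T u w\<close> with \<open>v < w\<close>
  produces zero divisors, \<open>T u w = a\<close> with \<open>u, w > a\<close>, and then \<open>min u w\<close> and \<open>a\<close> have the same
  square (\<open>gap_cancel\<close>). Hence each summand is strict. The minimum itself arises as the empty
  ordinal sum, and a strict t-norm as the ordinal sum over the single gap \<open>(0, 1)\<close>.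
\<close>


section \<open>Continuous t-norms\<close>

abbreviation unit_interval :: "real set" ("\<I>") where
  "\<I> \<equiv> {0..1}"

locale continuous_t_norm =
  fixes T :: "real \<Rightarrow> real \<Rightarrow> real"
  assumes continuous_tnorm: "continuous_tnorm T"
begin

lemma closed [simp]: "x \<in> \<I> \<Longrightarrow> y \<in> \<I> \<Longrightarrow> T x y \<in> \<I>"
  and commute: "x \<in> \<I> \<Longrightarrow> y \<in> \<I> \<Longrightarrow> T x y = T y x"
  and assoc: "x \<in> \<I> \<Longrightarrow> y \<in> \<I> \<Longrightarrow> z \<in> \<I> \<Longrightarrow> T (T x y) z = T x (T y z)"
  and mono_right: "x \<in> \<I> \<Longrightarrow> y \<in> \<I> \<Longrightarrow> z \<in> \<I> \<Longrightarrow> y \<le> z \<Longrightarrow> T x y \<le> T x z"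
  and mono_left: "x \<in> \<I> \<Longrightarrow> y \<in> \<I> \<Longrightarrow> z \<in> \<I> \<Longrightarrow> y \<le> z \<Longrightarrow> T y x \<le> T z x"
  and unit_right [simp]: "x \<in> \<I> \<Longrightarrow> T x 1 = x"
  and continuous: "continuous_on (\<I> \<times> \<I>) (\<lambda>(x, y). T x y)"
  using continuous_tnorm unfolding continuous_tnorm_def is_tnorm_def by blast+

lemma unit_left [simp]: "x \<in> \<I> \<Longrightarrow> T 1 x = x"
  using commute[of 1 x] by simp

lemma mono:
  assumes "x \<in> \<I>" "x' \<in> \<I>" "y \<in> \<I>" "y' \<in> \<I>" "x \<le> x'" "y \<le> y'"
  shows "T x y \<le> T x' y'"
  using mono_left[of y x x'] mono_right[of x' y y'] assms by linarith

lemma le_left: "x \<in> \<I> \<Longrightarrow> y \<in> \<I> \<Longrightarrow> T x y \<le> x"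
  using mono_right[of x y 1] by simp

lemma le_right: "x \<in> \<I> \<Longrightarrow> y \<in> \<I> \<Longrightarrow> T x y \<le> y"
  using le_left[of y x] commute[of x y] by simp

lemma zero_right [simp]: "x \<in> \<I> \<Longrightarrow> T x 0 = 0"
  using le_right[of x 0] closed[of x 0] by simp

text \<open>Regrouping four factors is what makes powers multiplicative.\<close>

lemma interchange:
  assumes "w \<in> \<I>" "x \<in> \<I>" "y \<in> \<I>" "z \<in> \<I>"
  shows "T (T w x) (T y z) = T (T w y) (T x z)"
proof -
  have "T (T w x) (T y z) = T w (T (T x y) z)"
    using assms by (simp only: assoc closed)
  also have "\<dots> = T w (T (T y x) z)"
    using assms commute[of x y] by simp
  also have "\<dots> = T (T w y) (T x z)"
    using assms by (simp only: assoc closed)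
  finally show ?thesis .
qed

lemma tendsto_T:
  assumes "f \<longlonglongrightarrow> x" "g \<longlonglongrightarrow> y" "\<And>n. f n \<in> \<I>" "\<And>n. g n \<in> \<I>"
  shows "(\<lambda>n. T (f n) (g n)) \<longlonglongrightarrow> T x y"
proof -
  have "x \<in> \<I>" "y \<in> \<I>"
    using assms closed_sequentially[of "\<I>"] by (metis closed_atLeastAtMost)+
  then show ?thesis
    using continuous_on_tendsto_compose[OF continuous tendsto_Pair[OF assms(1,2)]] assms(3,4)
    by (simp add: always_eventually)
qed

lemma continuous_on_T:
  assumes "continuous_on S f" "continuous_on S g" "f ` S \<subseteq> \<I>" "g ` S \<subseteq> \<I>"
  shows "continuous_on S (\<lambda>x. T (f x) (g x))"
  using continuous_on_compose2[OF continuous continuous_on_Pair[OF assms(1,2)]] assms(3,4)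
  by (auto simp: image_subset_iff)


section \<open>Powers with natural exponents\<close>

abbreviation pow :: "real \<Rightarrow> nat \<Rightarrow> real" where
  "pow \<equiv> tpow_nat T"

lemma pow_Suc: "x \<in> \<I> \<Longrightarrow> pow x (Suc n) = T (pow x n) x"
  by (cases n) auto

lemma pow_closed [simp]: "x \<in> \<I> \<Longrightarrow> pow x n \<in> \<I>"
proof (induction n)
  case (Suc n)
  then show ?case
    using closed by (simp only: pow_Suc)
qed auto

lemma pow_add: "x \<in> \<I> \<Longrightarrow> pow x (m + n) = T (pow x m) (pow x n)"
proof (induction n)
  case 0
  then show ?case by (metis add_0_right pow_closed tpow_nat.simps(1) unit_right)
next
  case (Suc n)
  then show ?case by (simp only: add_Suc_right pow_Suc assoc pow_closed)
qed

lemma pow_mult: "x \<in> \<I> \<Longrightarrow> pow x (m * n) = pow (pow x m) n"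
proof (induction n)
  case (Suc n)
  have "pow x (m * Suc n) = T (pow x (m * n)) (pow x m)"
    using pow_add[OF Suc.prems, of "m * n" m] by (simp add: add.commute)
  then show ?case
    using Suc by (simp only: pow_Suc pow_closed)
qed auto

lemma pow_T: "x \<in> \<I> \<Longrightarrow> y \<in> \<I> \<Longrightarrow> pow (T x y) n = T (pow x n) (pow y n)"
proof (induction n)
  case (Suc n)
  then show ?case
    by (simp only: pow_Suc closed interchange[of "pow x n" "pow y n" x y] pow_closed)
qed auto

lemma pow_mono: "x \<in> \<I> \<Longrightarrow> y \<in> \<I> \<Longrightarrow> x \<le> y \<Longrightarrow> pow x n \<le> pow y n"
proof (induction n)
  case (Suc n)
  then show ?case by (simp only: pow_Suc mono pow_closed)
qed auto

lemma pow_antimono: "x \<in> \<I> \<Longrightarrow> m \<le> n \<Longrightarrow> pow x n \<le> pow x m"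
  using pow_add[of x m "n - m"] le_left[OF pow_closed pow_closed, of x x m "n - m"] by simp

lemma pow_zero: "n \<ge> 1 \<Longrightarrow> pow 0 n = 0"
  using pow_antimono[of 0 1 n] pow_closed[of 0 n] by simp

lemma pow_one [simp]: "pow 1 n = 1"
proof (induction n)
  case (Suc n)
  then show ?case
    using pow_Suc[of 1 n] by simp
qed simp

lemma pow_continuous: "continuous_on \<I> (\<lambda>x. pow x n)"
proof (induction n)
  case (Suc n)
  have "continuous_on \<I> (\<lambda>x. T (pow x n) x)"
    using Suc by (intro continuous_on_T) (auto simp del: atLeastAtMost_iff)
  then show ?case
    by (rule continuous_on_eq) (simp only: pow_Suc)
qed simp

lemma pow_tendsto:
  assumes "f \<longlonglongrightarrow> x" "\<And>n. f n \<in> \<I>"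
  shows "(\<lambda>k. pow (f k) n) \<longlonglongrightarrow> pow x n"
proof -
  have "x \<in> \<I>"
    using assms closed_sequentially[of "\<I>"] by (metis closed_atLeastAtMost)
  then show ?thesis
    using continuous_on_tendsto_compose[OF pow_continuous assms(1)] assms(2)
    by (simp add: always_eventually)
qed


section \<open>Roots and powers with rational exponents\<close>

abbreviation root :: "real \<Rightarrow> nat \<Rightarrow> real" where
  "root \<equiv> troot T"

text \<open>
  By continuity the supremum that defines the root is attained as the least solution of
  \<open>v\<^sup>p = u\<close>. The resulting equivalence \<open>u\<^sup>1\<^sup>/\<^sup>p \<le> v \<longleftrightarrow> u \<le> v\<^sup>p\<close> says that rooting is lower adjoint
  to powering, and it is through this adjunction that roots are compared below.
\<close>

lemma root_basic:
  assumes u: "u \<in> \<I>" and p: "p \<ge> 1"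
  shows root_closed [simp]: "root u p \<in> \<I>"
    and pow_root: "pow (root u p) p = u"
    and root_le_iff: "\<And>v. v \<in> \<I> \<Longrightarrow> root u p \<le> v \<longleftrightarrow> u \<le> pow v p"
proof -
  define S where "S = {v \<in> \<I>. pow v p < u}"
  define r where "r = root u p"
  have r: "r = (if S = {} then 0 else Sup S)"
    by (simp only: r_def troot_def S_def Let_def)
  have bdd: "bdd_above S"
    by (auto simp: S_def intro!: bdd_aboveI[of _ 1])
  have *: "r \<in> \<I> \<and> pow r p = u \<and> (\<forall>v\<in>\<I>. u \<le> pow v p \<longrightarrow> r \<le> v)"
  proof (cases "u = 0")
    case True
    have "\<not> pow v p < u" if "v \<in> \<I>" for v
      using pow_closed[OF that, of p] True by simp
    then have "S = {}"
      by (auto simp: S_def)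
    then show ?thesis
      using r True pow_zero[OF p] by auto
  next
    case False
    have S0: "0 \<in> S"
      using False u pow_zero[OF p] by (auto simp: S_def)
    then have rS: "r = Sup S"
      using r by auto
    have least: "r \<le> v" if "v \<in> \<I>" "u \<le> pow v p" for v
      unfolding rS
    proof (rule cSup_least)
      fix s assume "s \<in> S"
      then show "s \<le> v"
        using that pow_mono[of v s p] by (force simp: S_def)
    qed (use S0 in auto)
    obtain w where w: "w \<in> \<I>" "pow w p = u"
      using IVT'[of "\<lambda>x. pow x p" 0 u 1] pow_zero[OF p] u pow_continuous by auto
    have rI: "r \<in> \<I>"
      using cSup_upper[OF S0 bdd] least[OF w(1)] w rS by auto
    have rw: "r \<le> w"
      using least w by simp
    have "pow r p \<ge> u"
    proof (rule ccontr)
      assume "\<not> ?thesis"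
      then have less: "pow r p < u"
        by simp
      \<comment> \<open>An intermediate value would belong to \<open>S\<close>, yet be attained to the right of its supremum.\<close>
      obtain x where x: "r \<le> x" "x \<le> w" "pow x p = (pow r p + u) / 2"
        using IVT'[of "\<lambda>x. pow x p" r "(pow r p + u) / 2" w] less w rw rI
          continuous_on_subset[OF pow_continuous, of "{r..w}" p] by auto
      then have "x \<in> S"
        using less rI w by (auto simp: S_def)
      then have "x = r"
        using cSup_upper[OF _ bdd, of x] rS x(1) by simp
      then show False
        using x(3) less by simp
    qed
    moreover have "pow r p \<le> u"
      using pow_mono[OF rI w(1) rw, of p] w by simp
    ultimately show ?thesis
      using rI least by auto
  qed
  then show 1: "root u p \<in> \<I>" and 2: "pow (root u p) p = u"
    by (simp_all add: r_def)
  show "root u p \<le> v \<longleftrightarrow> u \<le> pow v p" if "v \<in> \<I>" for v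
    using * that pow_mono[OF 1 that, of p] 2 by (auto simp: r_def)
qed

text \<open>Adjoints compose: both sides are lower adjoint to \<open>v \<mapsto> v\<^sup>p\<^sup>q\<close>.\<close>

lemma root_root:
  assumes "u \<in> \<I>" "p \<ge> 1" "q \<ge> 1"
  shows "root (root u p) q = root u (p * q)"
proof -
  have pq: "p * q \<ge> 1"
    using assms by simp
  have iff: "root (root u p) q \<le> v \<longleftrightarrow> root u (p * q) \<le> v" if "v \<in> \<I>" for v
    using assms that pq pow_mult[OF that, of q p] by (simp add: root_le_iff mult.commute del: atLeastAtMost_iff)
  show ?thesis
    using iff[of "root (root u p) q"] iff[of "root u (p * q)"] assms pq
    by (intro antisym) (simp_all del: atLeastAtMost_iff)
qed

lemma root_1 [simp]: "u \<in> \<I> \<Longrightarrow> root u (Suc 0) = u"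
  using pow_root[of u "Suc 0"] by simp

abbreviation frac :: "real \<Rightarrow> nat \<Rightarrow> nat \<Rightarrow> real" where
  "frac \<equiv> tpow_frac T"

lemma frac_closed [simp]: "u \<in> \<I> \<Longrightarrow> p \<ge> 1 \<Longrightarrow> frac u q p \<in> \<I>"
  unfolding tpow_frac_def by (intro pow_closed root_closed)

text \<open>
  Independence of the fraction: \<open>u\<^sup>1\<^sup>/\<^sup>p\<close> is the \<open>k\<close>-th power of its own \<open>k\<close>-th root \<open>u\<^sup>1\<^sup>/\<^sup>(\<^sup>p\<^sup>k\<^sup>)\<close>. It lets
  any two fractions be brought to a common denominator.
\<close>

lemma frac_expand:
  assumes "u \<in> \<I>" "p \<ge> 1" "k \<ge> 1"
  shows "frac u (q * k) (p * k) = frac u q p"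
proof -
  have "pow (root u (p * k)) k = root u p"
    using assms by (simp add: root_root[symmetric] pow_root del: atLeastAtMost_iff)
  moreover have "root u (p * k) \<in> \<I>"
    using assms by (intro root_closed) auto
  ultimately show ?thesis
    by (metis tpow_frac_def pow_mult mult.commute)
qed

lemma frac_antimono:
  assumes u: "u \<in> \<I>" and p: "p \<ge> 1" "p' \<ge> 1" and le: "real q / real p \<le> real q' / real p'"
  shows "frac u q' p' \<le> frac u q p"
proof -
  have "real (q * p') \<le> real (q' * p)"
    using le p by (simp add: field_simps)
  then have "q * p' \<le> q' * p"
    by (simp only: of_nat_le_iff)
  moreover have "root u (p * p') \<in> \<I>"
    using u p by (intro root_closed) auto
  ultimately have "frac u (q' * p) (p * p') \<le> frac u (q * p') (p * p')"
    unfolding tpow_frac_def by (intro pow_antimono)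
  then show ?thesis
    using frac_expand[OF u p] frac_expand[OF u p(2,1)] by (simp only: mult.commute[of p p'])
qed

lemma frac_add:
  assumes "u \<in> \<I>" "p \<ge> 1" "p' \<ge> 1"
  shows "T (frac u q p) (frac u q' p') = frac u (q * p' + q' * p) (p * p')"
proof -
  have "root u (p * p') \<in> \<I>"
    using assms by (intro root_closed) auto
  then have "T (frac u (q * p') (p * p')) (frac u (q' * p) (p' * p)) = frac u (q * p' + q' * p) (p * p')"
    unfolding tpow_frac_def by (simp add: pow_add mult.commute[of p'])
  then show ?thesis
    using assms by (simp only: frac_expand)
qed


section \<open>Powers with real exponents\<close>

abbreviation rpow :: "real \<Rightarrow> real \<Rightarrow> real" where
  "rpow \<equiv> tpow T"

text \<open>
  The numerator of the largest fraction in \<open>[0, t]\<close> with denominator \<open>n!\<close>. Since every \<open>p \<ge> 1\<close>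
  divides \<open>p!\<close>, these fractions dominate all the others, whether or not \<open>t\<close> is rational.
\<close>

definition approx :: "real \<Rightarrow> nat \<Rightarrow> nat" where
  "approx t n = nat \<lfloor>t * fact n\<rfloor>"

lemma approx_le: "t \<ge> 0 \<Longrightarrow> real (approx t n) / fact n \<le> t"
  by (simp add: approx_def divide_le_eq)

lemma approx_greatest:
  assumes "p dvd fact n" "real q / real p \<le> t"
  shows "real q / real p \<le> real (approx t n) / fact n"
proof -
  obtain k where k: "fact n = p * k"
    using assms by (auto simp: dvd_def)
  then have p: "p > 0" and k0: "k > 0"
    using fact_gt_zero[of n, where ?'a = nat] by (auto intro: Nat.gr0I)
  have kf: "(fact n :: real) = real p * real k"
    using k by (metis of_nat_fact of_nat_mult)
  have "real q \<le> t * real p"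
    using assms p by (simp add: field_simps)
  then have "real q * real k \<le> (t * real p) * real k"
    by (intro mult_right_mono) auto
  then have "q * k \<le> approx t n"
    unfolding approx_def by (intro le_nat_floor) (simp add: kf mult.assoc)
  then have "real q * real k \<le> real (approx t n)"
    by (metis of_nat_le_iff of_nat_mult)
  then have "real q * real k / (real p * real k) \<le> real (approx t n) / (real p * real k)"
    by (intro divide_right_mono) auto
  then show ?thesis
    using k0 by (simp add: kf)
qed

lemma approx_incseq:
  assumes "t \<ge> 0"
  shows "incseq (\<lambda>n. real (approx t n) / fact n)"
proof (rule incseq_SucI)
  fix n
  have "(fact n :: nat) dvd fact (Suc n)"
    by (simp add: fact_dvd)
  then show "real (approx t n) / fact n \<le> real (approx t (Suc n)) / fact (Suc n)"
    using approx_greatest[of "fact n" "Suc n" "approx t n" t] approx_le[OF assms, of n] by simp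
qed

lemma approx_tendsto:
  assumes "t \<ge> 0"
  shows "(\<lambda>n. real (approx t n) / fact n) \<longlonglongrightarrow> t"
proof (rule tendsto_sandwich)
  show "(\<lambda>n. t - inverse (real n)) \<longlonglongrightarrow> t"
    using tendsto_diff[OF tendsto_const[of t] lim_inverse_n] by simp
  show "\<forall>\<^sub>F n in sequentially. t - inverse (real n) \<le> real (approx t n) / fact n"
    using eventually_ge_at_top[of 1]
  proof eventually_elim
    case (elim n)
    have "t * fact n \<ge> 0"
      using assms by simp
    then have "t * fact n \<le> real (approx t n) + 1"
      unfolding approx_def by linarith
    then have "t * fact n / fact n \<le> (real (approx t n) + 1) / fact n"
      by (intro divide_right_mono) auto
    then have "t - inverse (fact n) \<le> real (approx t n) / fact n"
      by (simp add: add_divide_distrib inverse_eq_divide)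
    moreover have "real n \<le> fact n"
      by (metis fact_ge_self of_nat_fact of_nat_le_iff)
    then have "inverse (fact n) \<le> inverse (real n)"
      using elim by (intro le_imp_inverse_le) auto
    ultimately show ?case
      by linarith
  qed
  show "\<forall>\<^sub>F n in sequentially. real (approx t n) / fact n \<le> t"
    using approx_le[OF assms] by simp
qed simp

text \<open>
  The infimum over all fractions becomes the limit of one decreasing sequence, so that identities
  between powers with rational exponents can be carried over to real exponents.
\<close>

lemma rpow_limit:
  assumes u: "u \<in> \<I>" and t: "t \<ge> 0"
  shows "(\<lambda>n. frac u (approx t n) (fact n)) \<longlonglongrightarrow> rpow u t"
proof -
  define X where "X n = frac u (approx t n) (fact n)" for n
  have dec: "decseq X"
    unfolding decseq_def X_def
    by (intro allI impI frac_antimono) (use u monoD[OF approx_incseq[OF t]] in auto)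
  have bdd: "bdd_below (range X)"
    using frac_closed[OF u] by (auto simp: X_def intro!: bdd_belowI2[of _ 0])
  have "rpow u t = Inf (range X)"
    unfolding tpow_def
  proof (rule antisym)
    show "Inf {frac u q p |q p. 1 \<le> p \<and> real q / real p \<le> t} \<le> Inf (range X)"
    proof (rule cInf_superset_mono)
      show "bdd_below {frac u q p |q p. 1 \<le> p \<and> real q / real p \<le> t}"
        using frac_closed[OF u] by (auto intro!: bdd_belowI[of _ 0])
      show "range X \<subseteq> {frac u q p |q p. 1 \<le> p \<and> real q / real p \<le> t}"
        using approx_le[OF t] by (fastforce simp: X_def)
    qed simp
    show "Inf (range X) \<le> Inf {frac u q p |q p. 1 \<le> p \<and> real q / real p \<le> t}"
    proof (rule cInf_mono)
      fix b assume "b \<in> {frac u q p |q p. 1 \<le> p \<and> real q / real p \<le> t}"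
      then obtain q p where "b = frac u q p" "p \<ge> 1" "real q / real p \<le> t"
        by blast
      then have "X p \<le> b"
        using approx_greatest[of p p q t] dvd_fact[of p p] u unfolding X_def by (auto intro!: frac_antimono)
      then show "\<exists>a\<in>range X. a \<le> b"
        by blast
    next
      have "frac u 0 1 \<in> {frac u q p |q p. 1 \<le> p \<and> real q / real p \<le> t}"
        using t by force
      then show "{frac u q p |q p. 1 \<le> p \<and> real q / real p \<le> t} \<noteq> {}"
        by blast
    qed (use bdd in simp)
  qed
  then have "X \<longlonglongrightarrow> rpow u t"
    using LIMSEQ_decseq_INF[OF bdd dec] by simp
  then show ?thesis
    by (simp add: X_def[abs_def])
qed

lemma rpow_closed [simp]:
  assumes "u \<in> \<I>" "t \<ge> 0"
  shows "rpow u t \<in> \<I>"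
  using closed_sequentially[OF closed_atLeastAtMost _ rpow_limit[OF assms]] frac_closed[OF assms(1)]
  by (metis fact_ge_1)

lemma rpow_le_frac:
  assumes "u \<in> \<I>" "p \<ge> 1" "real q / real p \<le> t"
  shows "rpow u t \<le> frac u q p"
  unfolding tpow_def
  by (rule cInf_lower) (use assms frac_closed[OF assms(1)] in \<open>auto intro!: bdd_belowI[of _ 0]\<close>)

lemma le_rpowI:
  assumes "t \<ge> 0" "\<And>q p. p \<ge> 1 \<Longrightarrow> real q / real p \<le> t \<Longrightarrow> x \<le> frac u q p"
  shows "x \<le> rpow u t"
  unfolding tpow_def
proof (rule cInf_greatest)
  have "frac u 0 1 \<in> {frac u q p |q p. 1 \<le> p \<and> real q / real p \<le> t}"
    using assms(1) by force
  then show "{frac u q p |q p. 1 \<le> p \<and> real q / real p \<le> t} \<noteq> {}"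
    by blast
qed (use assms in auto)

lemma rpow_frac:
  assumes "u \<in> \<I>" "p \<ge> 1"
  shows "rpow u (real q / real p) = frac u q p"
  using assms by (intro antisym rpow_le_frac le_rpowI frac_antimono) auto

lemma rpow_antimono:
  assumes "u \<in> \<I>" "0 \<le> s" "s \<le> t"
  shows "rpow u t \<le> rpow u s"
  using assms by (intro le_rpowI rpow_le_frac) auto


section \<open>Idempotent elements\<close>

text \<open>The natural order is the divisibility order, by the intermediate value theorem.\<close>

lemma divides:
  assumes "x \<in> \<I>" "y \<in> \<I>" "x \<le> y"
  obtains z where "z \<in> \<I>" "T y z = x"
proof -
  have "continuous_on \<I> (\<lambda>z. T y z)"
    using assms by (intro continuous_on_T) auto
  then have "\<exists>z\<ge>0. z \<le> 1 \<and> T y z = x"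
    using assms by (intro IVT') auto
  then show thesis
    using that by auto
qed

definition idempotent :: "real \<Rightarrow> bool" where
  "idempotent e \<longleftrightarrow> e \<in> \<I> \<and> T e e = e"

lemma idempotent_0 [simp]: "idempotent 0" and idempotent_1 [simp]: "idempotent 1"
  by (simp_all add: idempotent_def)

text \<open>
  If \<open>x \<le> e\<close> then \<open>x\<close> is a multiple \<open>T e z\<close> of \<open>e\<close>, and the idempotent \<open>e\<close> absorbs a further factor \<open>e\<close>.
\<close>

lemma T_idempotent:
  assumes e: "idempotent e" and x: "x \<in> \<I>"
  shows "T x e = min x e"
proof (cases "x \<le> e")
  case True
  have eI: "e \<in> \<I>" and ee: "T e e = e"
    using e by (auto simp: idempotent_def)
  obtain z where z: "z \<in> \<I>" "T e z = x"
    using divides[OF x eI True] by blast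
  have "T x e = T e (T e z)"
    using commute[OF x eI] z by simp
  also have "\<dots> = T (T e e) z"
    using assoc[OF eI eI z(1)] by simp
  also have "\<dots> = x"
    using ee z by simp
  finally show ?thesis
    using True by simp
next
  case False
  then have "T e e \<le> T x e"
    using e x by (intro mono_left) (auto simp: idempotent_def)
  then show ?thesis
    using False e x le_right[of x e] by (auto simp: idempotent_def)
qed

text \<open>The limit is idempotent because \<open>T(z\<^sup>n, z\<^sup>n) = z\<^sup>2\<^sup>n\<close> has the same limit as \<open>z\<^sup>n\<close>.\<close>

lemma pow_limit_idempotent:
  assumes z: "z \<in> \<I>"
  obtains e where "idempotent e" "pow z \<longlonglongrightarrow> e" "\<And>n. e \<le> pow z n"
proof -
  have "decseq (pow z)"
    using pow_antimono[OF z] by (auto simp: decseq_def)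
  moreover have "bdd_below (range (pow z))"
    using pow_closed[OF z] by (auto intro!: bdd_belowI2[of _ 0])
  ultimately obtain e where lim: "pow z \<longlonglongrightarrow> e" and le: "\<And>n. e \<le> pow z n"
    using decseq_convergent[of "pow z" 0] pow_closed[OF z] by auto
  have "(\<lambda>n. T (pow z n) (pow z n)) \<longlonglongrightarrow> T e e"
    using lim by (intro tendsto_T) (use pow_closed[OF z] in auto)
  moreover have "(\<lambda>n. T (pow z n) (pow z n)) = (\<lambda>n. pow z (n + n))"
    using pow_add[OF z] by simp
  moreover have "(\<lambda>n. pow z (n + n)) \<longlonglongrightarrow> e"
    using LIMSEQ_subseq_LIMSEQ[OF lim, of "\<lambda>n. n + n"] by (auto simp: strict_mono_def o_def)
  ultimately have "T e e = e"
    using LIMSEQ_unique by metis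
  moreover have "e \<in> \<I>"
    using closed_sequentially[OF closed_atLeastAtMost _ lim] pow_closed[OF z] by blast
  ultimately show thesis
    using that[of e] lim le by (simp add: idempotent_def)
qed

text \<open>
  Along denominators \<open>2\<^sup>n\<close> each root is the square of the next one, so their limit is its own square.
\<close>

lemma root_limit_idempotent:
  assumes u: "u \<in> \<I>"
  obtains e where "idempotent e" "(\<lambda>n. root u (2 ^ n)) \<longlonglongrightarrow> e" "\<And>n. root u (2 ^ n) \<le> e"
proof -
  define g where "g n = root u (2 ^ n)" for n
  have gI: "g n \<in> \<I>" for n
    unfolding g_def using u by (intro root_closed) auto
  have square: "T (g (Suc n)) (g (Suc n)) = g n" for n
  proof -
    have "pow (root (g n) 2) 2 = g n"
      using gI by (intro pow_root) auto
    moreover have "root (g n) 2 = g (Suc n)"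
      unfolding g_def using u by (simp add: root_root mult.commute)
    ultimately show ?thesis
      by (simp add: numeral_2_eq_2)
  qed
  have "incseq g"
    using square le_left[OF gI gI] by (intro incseq_SucI) metis
  then obtain e where lim: "g \<longlonglongrightarrow> e" and le: "\<And>n. g n \<le> e"
    using incseq_convergent[of g 1] gI by auto
  have "(\<lambda>n. T (g (Suc n)) (g (Suc n))) \<longlonglongrightarrow> T e e"
    using lim gI by (intro tendsto_T LIMSEQ_Suc) auto
  then have "T e e = e"
    using lim LIMSEQ_unique unfolding square by metis
  moreover have "e \<in> \<I>"
    using closed_sequentially[OF closed_atLeastAtMost _ lim] gI by blast
  ultimately show thesis
    using that[of e] lim le by (simp add: idempotent_def g_def[abs_def])
qed


section \<open>Left continuity in the exponent\<close>

text \<open>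
  A one-sided form of \<open>u\<^sup>s\<^sup>+\<^sup>1\<^sup>/\<^sup>k = T(u\<^sup>s, u\<^sup>1\<^sup>/\<^sup>k)\<close>. The strict inequality \<open>t < s + 1 / k\<close> leaves room for a
  fraction \<open>r \<le> s\<close> with \<open>t \<le> r + 1 / k\<close>, and exponents that are fractions do add up.
\<close>

lemma T_rpow_root_le:
  assumes u: "u \<in> \<I>" and k: "k \<ge> 1" and s: "0 \<le> s" "t < s + 1 / real k" and t: "t \<ge> 0"
  shows "T (rpow u s) (root u k) \<le> rpow u t"
proof -
  have "\<forall>\<^sub>F n in sequentially. t - 1 / real k < real (approx s n) / fact n"
    using order_tendstoD(1)[OF approx_tendsto[OF s(1)]] s by simp
  then obtain n where n: "t - 1 / real k < real (approx s n) / fact n"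
    by (auto simp: eventually_sequentially)
  define q where "q = approx s n"
  define p :: nat where "p = fact n"
  have p: "p \<ge> 1"
    by (simp add: p_def)
  have qp: "t - 1 / real k < real q / real p" "real q / real p \<le> s"
    using n approx_le[OF s(1), of n] by (simp_all add: q_def p_def)
  have "T (rpow u s) (root u k) \<le> T (frac u q p) (root u k)"
    using u k s p qp by (intro mono_left rpow_le_frac rpow_closed frac_closed root_closed)
  also have "\<dots> = frac u (q * k + p) (p * k)"
    using frac_add[OF u p k, of q 1] by (simp add: tpow_frac_def)
  also have "\<dots> = rpow u (real (q * k + p) / real (p * k))"
    using rpow_frac[OF u, of "p * k" "q * k + p"] p k by simp
  also have "\<dots> \<le> rpow u t"
  proof (rule rpow_antimono[OF u t])
    have "real (q * k + p) / real (p * k) = real q / real p + 1 / real k"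
      using p k by (simp add: field_simps)
    then show "t \<le> real (q * k + p) / real (p * k)"
      using qp by linarith
  qed
  finally show ?thesis .
qed

text \<open>
  Let \<open>L\<close> be the limit of the powers \<open>u\<^sup>s\<close> and \<open>e\<close> the limit of the roots of \<open>u\<close>. The preceding
  inequality yields \<open>T L e \<le> u\<^sup>t\<close> in the limit, first in \<open>s\<close> and then in \<open>k\<close>. As \<open>L \<le> e\<close> and \<open>e\<close> is
  idempotent, the left-hand side is \<open>L\<close>.
\<close>

lemma rpow_left_continuous:
  assumes u: "u \<in> \<I>" and t: "t > 0"
    and s: "incseq s" "s \<longlonglongrightarrow> t" "\<And>n. 0 \<le> s n"
  shows "(\<lambda>n. rpow u (s n)) \<longlonglongrightarrow> rpow u t"
proof -
  define F where "F n = rpow u (s n)" for n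
  have FI: "F n \<in> \<I>" for n
    unfolding F_def using u s by (intro rpow_closed)
  have st: "s n \<le> t" for n
    using incseq_le[OF s(1,2)] .
  have "decseq F"
    unfolding F_def decseq_def using u s by (auto intro!: rpow_antimono simp: incseq_def)
  then obtain L where L: "F \<longlonglongrightarrow> L"
    using decseq_convergent[of F 0] FI by (metis atLeastAtMost_iff)
  have LI: "L \<in> \<I>"
    using closed_sequentially[OF closed_atLeastAtMost _ L] FI by blast
  have "rpow u t \<le> F n" for n
    unfolding F_def using u s st by (intro rpow_antimono)
  then have 1: "rpow u t \<le> L"
    using LIMSEQ_le_const[OF L] by blast
  obtain e where e: "idempotent e" "(\<lambda>k. root u (2 ^ k)) \<longlonglongrightarrow> e" "\<And>k. root u (2 ^ k) \<le> e"
    using root_limit_idempotent[OF u] by blast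
  have rI: "root u (2 ^ k) \<in> \<I>" for k
    using u by (intro root_closed) auto
  have Lk: "T L (root u (2 ^ k)) \<le> rpow u t" for k
  proof (rule LIMSEQ_le_const2)
    show "(\<lambda>n. T (F n) (root u (2 ^ k))) \<longlonglongrightarrow> T L (root u (2 ^ k))"
      using L FI rI by (intro tendsto_T) auto
    have "\<forall>\<^sub>F n in sequentially. t - 1 / real (2 ^ k) < s n"
      using order_tendstoD(1)[OF s(2)] by simp
    then obtain N where N: "\<And>n. n \<ge> N \<Longrightarrow> t - 1 / real (2 ^ k) < s n"
      by (auto simp: eventually_sequentially)
    have "T (F n) (root u (2 ^ k)) \<le> rpow u t" if "n \<ge> N" for n
      unfolding F_def using u t s(3)[of n] N[OF that] by (intro T_rpow_root_le) auto
    then show "\<exists>N. \<forall>n\<ge>N. T (F n) (root u (2 ^ k)) \<le> rpow u t"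
      by blast
  qed
  have "(\<lambda>k. T L (root u (2 ^ k))) \<longlonglongrightarrow> T L e"
    using e rI LI by (intro tendsto_T) auto
  then have "T L e \<le> rpow u t"
    using Lk by (intro LIMSEQ_le_const2) auto
  moreover have "L \<le> e"
  proof -
    obtain k :: nat where k: "1 / t < 2 ^ k"
      using real_arch_pow[of 2 "1 / t"] by auto
    then have "1 / 2 ^ k < t"
      using t by (simp add: field_simps)
    then obtain n where "1 / 2 ^ k < s n"
      using order_tendstoD(1)[OF s(2)] by (metis eventually_sequentially order_refl)
    then have "F n \<le> frac u 1 (2 ^ k)"
      unfolding F_def using u by (intro rpow_le_frac) auto
    also have "\<dots> \<le> e"
      using e(3) by (simp add: tpow_frac_def)
    finally show ?thesis
      using decseq_ge[OF \<open>decseq F\<close> L, of n] by simp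
  qed
  ultimately have "L = rpow u t"
    using 1 T_idempotent[OF e(1) LI] by simp
  then show ?thesis
    using L by (simp add: F_def[abs_def])
qed

end


section \<open>Injectivity of squaring\<close>

context continuous_t_norm
begin

text \<open>
  For \<open>x \<le> y\<close> the mixed product \<open>y\<^sup>n x\<close> is squeezed between \<open>x\<^sup>n\<^sup>+\<^sup>1\<close> and \<open>y\<^sup>n\<^sup>+\<^sup>1\<close>, so it equals
  both, and factors \<open>x\<close> may be traded for factors \<open>y\<close>.
\<close>

lemma pow_eq_Suc:
  assumes xy: "x \<in> \<I>" "y \<in> \<I>" "x \<le> y" and eq: "pow x (Suc n) = pow y (Suc n)"
  shows "pow x (Suc (Suc n)) = pow y (Suc (Suc n))"
proof -
  have "T (pow x n) x \<le> T (pow y n) x" "T (pow y n) x \<le> T (pow y n) y"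
    using xy by (auto intro!: mono_left mono_right pow_mono pow_closed simp del: atLeastAtMost_iff)
  then have 1: "T (pow y n) x = pow y (Suc n)"
    using eq xy by (simp only: pow_Suc)
  have "pow x (Suc (Suc n)) = T (pow y (Suc n)) x"
    using xy eq by (simp only: pow_Suc)
  also have "\<dots> = T (T (pow y n) x) y"
    using xy by (simp only: pow_Suc assoc pow_closed commute[of x y])
  also have "\<dots> = pow y (Suc (Suc n))"
    using xy 1 by (simp only: pow_Suc)
  finally show ?thesis .
qed

lemma pow_eq_mono:
  assumes xy: "x \<in> \<I>" "y \<in> \<I>" "x \<le> y" and n: "1 \<le> n" "n \<le> m" and eq: "pow x n = pow y n"
  shows "pow x m = pow y m"
  using n(2)
proof (induction m rule: dec_induct)
  case (step m)
  then obtain k where "m = Suc k"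
    using n(1) by (cases m) auto
  then show ?case
    using step pow_eq_Suc[OF xy] by simp
qed (rule eq)

end

locale square_injective_t_norm = continuous_t_norm +
  assumes square_injective: "\<lbrakk>x \<in> \<I>; y \<in> \<I>; T x x = T y y\<rbrakk> \<Longrightarrow> x = y"
begin

lemma pow_two_power_injective:
  assumes xy: "x \<in> \<I>" "y \<in> \<I>" and eq: "pow x (2 ^ k) = pow y (2 ^ k)"
  shows "x = y"
  using eq
proof (induction k)
  case (Suc k)
  have "T (pow x (2 ^ k)) (pow x (2 ^ k)) = T (pow y (2 ^ k)) (pow y (2 ^ k))"
    using Suc.prems pow_add[OF xy(1)] pow_add[OF xy(2)] by (simp add: mult_2)
  then show ?case
    using Suc.IH square_injective xy pow_closed by blast
qed simp

text \<open>
  Iterated squaring gives the exponents that are powers of two. If two elements have equal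
  \<open>n\<close>-th powers, then also equal powers of any larger exponent, in particular of \<open>2\<^sup>n\<close>.
\<close>

lemma pow_injective:
  assumes xy: "x \<in> \<I>" "y \<in> \<I>" and n: "n \<ge> 1" and eq: "pow x n = pow y n"
  shows "x = y"
proof -
  have "n \<le> 2 ^ n"
    by (rule less_imp_le[OF less_exp])
  then have "pow x (2 ^ n) = pow y (2 ^ n)"
    using pow_eq_mono[OF xy _ n, of "2 ^ n"] pow_eq_mono[OF xy(2,1) _ n, of "2 ^ n"] eq by fastforce
  then show ?thesis
    by (rule pow_two_power_injective[OF xy])
qed

text \<open>
  This is where injectivity enters: without it, the root of \<open>v\<^sup>p\<close> may be smaller than \<open>v\<close>.
\<close>

lemma root_unique:
  assumes "v \<in> \<I>" "p \<ge> 1" "pow v p = u"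
  shows "root u p = v"
proof -
  have u: "u \<in> \<I>"
    using assms pow_closed by blast
  show ?thesis
    by (rule pow_injective[OF root_closed[OF u assms(2)] assms(1,2)])
      (simp only: pow_root[OF u assms(2)] assms(3))
qed

lemma root_T:
  assumes "u \<in> \<I>" "v \<in> \<I>" "p \<ge> 1"
  shows "root (T u v) p = T (root u p) (root v p)"
proof (rule root_unique)
  have r: "root u p \<in> \<I>" "root v p \<in> \<I>"
    using assms by (auto intro!: root_closed simp del: atLeastAtMost_iff)
  then show "T (root u p) (root v p) \<in> \<I>"
    by (rule closed)
  show "pow (T (root u p) (root v p)) p = T u v"
    using assms r by (simp only: pow_T pow_root)
qed fact

lemma root_pow:
  assumes "u \<in> \<I>" "p \<ge> 1"
  shows "root (pow u q) p = pow (root u p) q"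
proof (rule root_unique)
  have r: "root u p \<in> \<I>"
    using assms by (rule root_closed)
  then show "pow (root u p) q \<in> \<I>"
    by (rule pow_closed)
  show "pow (pow (root u p) q) p = pow u q"
    using assms r pow_mult[OF r, of q p] pow_mult[OF r, of p q] by (simp add: pow_root mult.commute)
qed fact

text \<open>
  The roots of a decreasing sequence decrease, and the \<open>p\<close>-th power of their limit is \<open>u\<close> because
  powering is continuous; injectivity identifies this limit as the root of \<open>u\<close>.
\<close>

lemma root_tendsto:
  assumes f: "f \<longlonglongrightarrow> u" "decseq f" "\<And>n. f n \<in> \<I>" and p: "p \<ge> 1"
  shows "(\<lambda>n. root (f n) p) \<longlonglongrightarrow> root u p"
proof -
  define X where "X n = root (f n) p" for n
  have XI: "X n \<in> \<I>" for n
    unfolding X_def using f p by (intro root_closed)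
  have "decseq X"
    unfolding decseq_def
  proof (intro allI impI)
    fix m n :: nat
    assume "m \<le> n"
    then have "f n \<le> f m"
      using f(2) by (simp add: decseq_def)
    then show "X n \<le> X m"
      using root_le_iff[OF f(3) p XI, of n m] pow_root[OF f(3) p] by (simp add: X_def)
  qed
  then obtain L where L: "X \<longlonglongrightarrow> L"
    using decseq_convergent[of X 0] XI by (metis atLeastAtMost_iff)
  have LI: "L \<in> \<I>"
    using closed_sequentially[OF closed_atLeastAtMost _ L] XI by blast
  have "(\<lambda>n. pow (X n) p) \<longlonglongrightarrow> pow L p"
    using L XI by (rule pow_tendsto)
  then have "f \<longlonglongrightarrow> pow L p"
    unfolding X_def using pow_root[OF f(3) p] by simp
  then have "pow L p = u"
    using f(1) LIMSEQ_unique by blast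
  then have "root u p = L"
    using root_unique LI p by blast
  then show ?thesis
    using L by (simp add: X_def[abs_def])
qed

lemma frac_T:
  assumes "u \<in> \<I>" "v \<in> \<I>" "p \<ge> 1"
  shows "frac (T u v) q p = T (frac u q p) (frac v q p)"
  using assms by (simp only: tpow_frac_def root_T pow_T root_closed)

lemma frac_frac:
  assumes u: "u \<in> \<I>" and p: "p \<ge> 1" "p' \<ge> 1"
  shows "frac (frac u q p) q' p' = frac u (q * q') (p * p')"
proof -
  have r: "root u p \<in> \<I>"
    using u p by (intro root_closed)
  have "root u (p * p') \<in> \<I>"
    using u p by (intro root_closed) auto
  then show ?thesis
    unfolding tpow_frac_def
    using root_pow[OF r p(2)] root_root[OF u p] pow_mult[of "root u (p * p')" q q'] by simp
qed

section \<open>Power stability when squaring is injective\<close>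

theorem power_stable: "power_stable T"
  unfolding power_stable_def
proof (intro ballI allI impI)
  fix u v t :: real
  assume u: "u \<in> \<I>" and v: "v \<in> \<I>" and "t > 0"
  then have t: "t \<ge> 0"
    by simp
  have "(\<lambda>n. T (frac u (approx t n) (fact n)) (frac v (approx t n) (fact n)))
      \<longlonglongrightarrow> T (rpow u t) (rpow v t)"
    using u v t by (intro tendsto_T rpow_limit frac_closed) auto
  then have "(\<lambda>n. frac (T u v) (approx t n) (fact n)) \<longlonglongrightarrow> T (rpow u t) (rpow v t)"
    using u v by (simp only: frac_T fact_ge_1)
  then show "rpow (T u v) t = T (rpow u t) (rpow v t)"
    using LIMSEQ_unique rpow_limit[OF closed[OF u v] t] by blast
qed

text \<open>
  The exponent law with a rational outer exponent: it holds for the fractions approaching \<open>t\<close> and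
  survives the limit on the left by continuity of roots and powers, on the right by left
  continuity in the exponent.
\<close>

lemma frac_rpow:
  assumes u: "u \<in> \<I>" and t: "t > 0" and p: "p \<ge> 1"
  shows "frac (rpow u t) q p = rpow u (t * (real q / real p))"
proof (cases "q = 0")
  case True
  have "rpow u (real 0 / real 1) = frac u 0 1"
    using u by (intro rpow_frac) auto
  then show ?thesis
    using True by (simp add: tpow_frac_def)
next
  case False
  define f where "f n = frac u (approx t n) (fact n)" for n
  define s where "s n = real (approx t n) / fact n" for n
  have f: "f \<longlonglongrightarrow> rpow u t"
    unfolding f_def[abs_def] using u t by (intro rpow_limit) auto
  have fI: "f n \<in> \<I>" for n
    unfolding f_def using u by (intro frac_closed) auto
  have s: "incseq s" "s \<longlonglongrightarrow> t" "\<And>n. 0 \<le> s n"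
    unfolding s_def[abs_def] using t approx_incseq approx_tendsto by auto
  have fs: "f n = rpow u (s n)" for n
    using rpow_frac[OF u, of "fact n" "approx t n"] by (simp add: f_def s_def)
  have "decseq f"
    unfolding decseq_def fs using u s by (auto intro!: rpow_antimono simp: incseq_def)
  then have "(\<lambda>n. root (f n) p) \<longlonglongrightarrow> root (rpow u t) p"
    using f fI p by (intro root_tendsto)
  then have 1: "(\<lambda>n. frac (f n) q p) \<longlonglongrightarrow> frac (rpow u t) q p"
    unfolding tpow_frac_def using fI p by (intro pow_tendsto root_closed)
  have 2: "frac (f n) q p = rpow u (s n * (real q / real p))" for n
  proof -
    have "frac (f n) q p = frac u (approx t n * q) (fact n * p)"
      unfolding f_def using u p by (intro frac_frac) auto
    also have "\<dots> = rpow u (real (approx t n * q) / real (fact n * p))"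
      using u p by (intro rpow_frac[symmetric]) auto
    also have "real (approx t n * q) / real (fact n * p) = s n * (real q / real p)"
      by (simp add: s_def)
    finally show ?thesis .
  qed
  have "(\<lambda>n. rpow u (s n * (real q / real p))) \<longlonglongrightarrow> rpow u (t * (real q / real p))"
  proof (rule rpow_left_continuous[OF u])
    show "0 < t * (real q / real p)"
      using t False p by simp
    show "incseq (\<lambda>n. s n * (real q / real p))"
      using s(1) unfolding incseq_def by (auto intro!: mult_right_mono simp del: times_divide_eq_right)
    show "(\<lambda>n. s n * (real q / real p)) \<longlonglongrightarrow> t * (real q / real p)"
      using s(2) by (rule tendsto_mult_right)
    show "0 \<le> s n * (real q / real p)" for n
      using s(3) by (simp del: times_divide_eq_right)
  qed
  then show ?thesis
    using 1 LIMSEQ_unique unfolding 2 by blast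
qed

theorem power_stable_element:
  assumes u: "u \<in> \<I>"
  shows "power_stable_element T u"
  unfolding power_stable_element_def
proof (intro allI impI)
  fix t1 t2 :: real
  assume t1: "t1 > 0" and t2: "t2 > 0"
  define s where "s n = real (approx t2 n) / fact n" for n
  have s: "incseq s" "s \<longlonglongrightarrow> t2" "\<And>n. 0 \<le> s n"
    unfolding s_def[abs_def] using t2 approx_incseq approx_tendsto by auto
  have "(\<lambda>n. frac (rpow u t1) (approx t2 n) (fact n)) \<longlonglongrightarrow> rpow (rpow u t1) t2"
    using u t1 t2 by (intro rpow_limit rpow_closed) auto
  moreover have eq: "frac (rpow u t1) (approx t2 n) (fact n) = rpow u (t1 * s n)" for n
    using frac_rpow[OF u t1, of "fact n"] by (simp add: s_def)
  moreover have "(\<lambda>n. rpow u (t1 * s n)) \<longlonglongrightarrow> rpow u (t1 * t2)"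
    using u t1 t2 s by (intro rpow_left_continuous tendsto_mult_left) (auto simp: incseq_def)
  ultimately show "rpow (rpow u t1) t2 = rpow u (t1 * t2)"
    unfolding eq using LIMSEQ_unique by blast
qed

end


section \<open>Power stability forces squaring to be injective\<close>

context continuous_t_norm
begin

lemma rpow_1: "u \<in> \<I> \<Longrightarrow> rpow u 1 = u"
  using rpow_frac[of u 1 1] by (simp add: tpow_frac_def)

lemma rpow_2: "u \<in> \<I> \<Longrightarrow> rpow u 2 = T u u"
  using rpow_frac[of u 1 2] by (simp add: tpow_frac_def numeral_2_eq_2)

lemma rpow_half: "u \<in> \<I> \<Longrightarrow> rpow u (1 / 2) = root u 2"
  using rpow_frac[of u 2 1] by (simp add: tpow_frac_def)

lemma square_root_imp_square_injective:
  assumes "\<And>x. x \<in> \<I> \<Longrightarrow> root (T x x) 2 = x"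
  shows "square_injective_t_norm T"
proof
  show "x = y" if "x \<in> \<I>" "y \<in> \<I>" "T x x = T y y" for x y
    using assms that by metis
qed

lemma power_stable_imp_square_injective:
  assumes "power_stable T"
  shows "square_injective_t_norm T"
proof (rule square_root_imp_square_injective)
  fix x assume x: "x \<in> \<I>"
  then have "rpow (T x x) (1 / 2) = T (rpow x (1 / 2)) (rpow x (1 / 2))"
    using assms by (simp add: power_stable_def)
  then have "root (T x x) 2 = T (root x 2) (root x 2)"
    using x by (simp only: rpow_half closed)
  also have "\<dots> = x"
    using pow_root[OF x, of 2] by (simp add: numeral_2_eq_2)
  finally show "root (T x x) 2 = x" .
qed

lemma power_stable_elements_imp_square_injective:
  assumes "\<forall>u\<in>\<I>. power_stable_element T u"
  shows "square_injective_t_norm T"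
proof (rule square_root_imp_square_injective)
  fix x assume x: "x \<in> \<I>"
  then have "rpow (rpow x 2) (1 / 2) = rpow x (2 * (1 / 2))"
    using assms unfolding power_stable_element_def by (meson half_gt_zero_iff zero_less_numeral zero_less_one)
  then show "root (T x x) 2 = x"
    using x by (simp add: rpow_half rpow_1 rpow_2 del: atLeastAtMost_iff)
qed


section \<open>The gaps between idempotent elements\<close>

lemma compact_idempotents: "compact {x. idempotent x}"
proof -
  have "continuous_on \<I> (\<lambda>x. T x x - x)"
    by (intro continuous_intros continuous_on_T) auto
  then have "closed {x \<in> \<I>. T x x - x = 0}"
    using continuous_closed_preimage_constant closed_atLeastAtMost by blast
  moreover have "{x \<in> \<I>. T x x - x = 0} = {x. idempotent x}"
    by (auto simp: idempotent_def)
  moreover have "bounded {x. idempotent x}"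
    by (rule bounded_subset[OF bounded_closed_interval[of 0 1]]) (auto simp: idempotent_def)
  ultimately show ?thesis
    by (simp add: compact_eq_bounded_closed)
qed

text \<open>The components \<open>(a, e)\<close> of the complement of the set of idempotent elements.\<close>

definition gap :: "real \<Rightarrow> real \<Rightarrow> bool" where
  "gap a e \<longleftrightarrow> idempotent a \<and> idempotent e \<and> a < e \<and> (\<forall>x. a < x \<and> x < e \<longrightarrow> \<not> idempotent x)"

lemma gapD:
  assumes "gap a e"
  shows "idempotent a" "idempotent e" "a \<in> \<I>" "e \<in> \<I>" "0 \<le> a" "a < e" "e \<le> 1"
  using assms by (auto simp: gap_def idempotent_def)

lemma gap_around:
  assumes x: "x \<in> \<I>" "\<not> idempotent x"
  obtains a e where "gap a e" "a < x" "x < e"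
proof -
  have "compact ({y. idempotent y} \<inter> {..x})" "0 \<in> {y. idempotent y} \<inter> {..x}"
    using compact_idempotents x by (auto intro: compact_Int_closed)
  then obtain a
    where a: "a \<in> {y. idempotent y} \<inter> {..x}" "\<forall>y\<in>{y. idempotent y} \<inter> {..x}. y \<le> a"
    using compact_attains_sup[of "{y. idempotent y} \<inter> {..x}"] by blast
  have "compact ({y. idempotent y} \<inter> {x..})" "1 \<in> {y. idempotent y} \<inter> {x..}"
    using compact_idempotents x by (auto intro: compact_Int_closed)
  then obtain e
    where e: "e \<in> {y. idempotent y} \<inter> {x..}" "\<forall>y\<in>{y. idempotent y} \<inter> {x..}. e \<le> y"
    using compact_attains_inf[of "{y. idempotent y} \<inter> {x..}"] by blast
  have less: "a < x" "x < e"
    using a(1) e(1) x(2) by (auto simp: order_less_le)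
  have "\<not> idempotent y" if "a < y" "y < e" for y
    using that a(2) e(2) by (cases "y \<le> x") force+
  then have "gap a e"
    using a(1) e(1) less by (auto simp: gap_def)
  then show thesis
    using that less by blast
qed

lemma gap_unique:
  assumes "gap a e" "gap a' e'" "a < x" "x < e" "a' < x" "x < e'"
  shows "a = a'" "e = e'"
proof -
  have "\<not> a < a'" "\<not> a' < a" "\<not> e < e'" "\<not> e' < e"
    using assms unfolding gap_def by (meson less_trans)+
  then show "a = a'" "e = e'"
    by auto
qed

text \<open>
  If neither argument is idempotent, the gap of the smaller argument \<open>u\<close> ends at an idempotent \<open>e\<close>
  below the larger argument \<open>v\<close>, and \<open>u = T u e \<le> T u v \<le> u\<close>.
\<close>

lemma T_eq_min_outside_gaps:
  assumes uv: "u \<in> \<I>" "v \<in> \<I>"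
    and out: "\<And>a e. gap a e \<Longrightarrow> u \<in> {a..e} \<Longrightarrow> v \<in> {a..e} \<Longrightarrow> False"
  shows "T u v = min u v"
proof -
  have *: "T u v = min u v"
    if uv: "u \<in> \<I>" "v \<in> \<I>" "u \<le> v"
      and out: "\<And>a e. gap a e \<Longrightarrow> u \<in> {a..e} \<Longrightarrow> v \<in> {a..e} \<Longrightarrow> False" for u v
  proof (cases "idempotent u")
    case True
    then show ?thesis
      using T_idempotent[of u v] commute[of u v] uv by (simp add: min.commute)
  next
    case False
    then obtain a e where g: "gap a e" "a < u" "u < e"
      using gap_around uv by metis
    then have "e < v"
      using out[OF g(1)] uv by force
    then have "T u e \<le> T u v"
      using uv gapD[OF g(1)] by (intro mono_right) auto
    moreover have "T u e = u"
      using T_idempotent[OF gapD(2)[OF g(1)] uv(1)] g by simp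
    ultimately show ?thesis
      using le_left[of u v] uv by simp
  qed
  show ?thesis
  proof (cases "u \<le> v")
    case True
    then show ?thesis
      using * uv out by blast
  next
    case False
    then have "T v u = min v u"
      using uv out by (intro *) auto
    then show ?thesis
      using commute[OF uv] by (simp add: min.commute)
  qed
qed

text \<open>
  The conjugate of \<open>T\<close> by the increasing affine bijection from \<open>[0, 1]\<close> onto \<open>[a, e]\<close>.
\<close>

definition rescale :: "real \<Rightarrow> real \<Rightarrow> real \<Rightarrow> real \<Rightarrow> real" where
  "rescale a e x y = (T (a + (e - a) * x) (a + (e - a) * y) - a) / (e - a)"

lemma T_eq_rescale:
  assumes "a < e"
  shows "T u v = a + (e - a) * rescale a e ((u - a) / (e - a)) ((v - a) / (e - a))"
  using assms by (simp add: rescale_def)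

lemma T_closed_between:
  assumes "idempotent a" "e \<in> \<I>" "u \<in> {a..e}" "v \<in> {a..e}"
  shows "T u v \<in> {a..e}"
proof -
  have I: "a \<in> \<I>" "u \<in> \<I>" "v \<in> \<I>" "T a a = a"
    using assms by (auto simp: idempotent_def)
  then have "T a a \<le> T u v"
    using assms by (intro mono) auto
  then show ?thesis
    using I le_left[of u v] assms by simp
qed

text \<open>
  Every axiom is transported along the affine bijection \<open>L\<close>; idempotence of \<open>a\<close> keeps the values in
  \<open>[a, e]\<close>, and idempotence of \<open>e\<close> makes it the unit there.
\<close>

lemma continuous_tnorm_rescale:
  assumes a: "idempotent a" and e: "idempotent e" and "a < e"
  shows "continuous_tnorm (rescale a e)"
proof -
  define L where "L x = a + (e - a) * x" for x
  have ae: "e - a > 0" "a \<in> \<I>" "e \<in> \<I>" "0 \<le> a" "e \<le> 1"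
    using assms by (auto simp: idempotent_def)
  have L: "L x \<in> {a..e}" if "x \<in> \<I>" for x
  proof -
    have "(e - a) * x \<le> (e - a) * 1" "0 \<le> (e - a) * x"
      using that ae by (intro mult_left_mono mult_nonneg_nonneg; simp)+
    then show ?thesis
      by (simp add: L_def)
  qed
  have LI: "L x \<in> \<I>" if "x \<in> \<I>" for x
    using L[OF that] ae by auto
  have inv: "L (rescale a e x y) = T (L x) (L y)" for x y
    using ae by (simp add: L_def rescale_def)
  have le: "L x \<le> L y \<longleftrightarrow> x \<le> y" for x y
    using ae by (simp add: L_def)
  have eq: "L x = L y \<longleftrightarrow> x = y" for x y
    using ae by (simp add: L_def)
  have bd: "L x \<in> {a..e} \<longleftrightarrow> x \<in> \<I>" for x
    using le[of 0 x] le[of x 1] by (auto simp: L_def)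
  have 1: "rescale a e x y \<in> \<I>" if "x \<in> \<I>" "y \<in> \<I>" for x y
    using T_closed_between[OF a ae(3) L[OF that(1)] L[OF that(2)]] by (simp only: inv[symmetric] bd)
  have "is_tnorm (rescale a e)"
    unfolding is_tnorm_def
  proof (intro conjI ballI impI)
    fix x y z assume x: "x \<in> \<I>" and y: "y \<in> \<I>" and z: "z \<in> \<I>"
    show "rescale a e x y \<in> \<I>"
      using 1 x y .
    show "rescale a e x y = rescale a e y x"
      by (rule iffD1[OF eq]) (simp only: inv commute[OF LI[OF x] LI[OF y]])
    show "rescale a e (rescale a e x y) z = rescale a e x (rescale a e y z)"
      by (rule iffD1[OF eq]) (simp only: inv assoc LI x y z)
    show "rescale a e x y \<le> rescale a e x z" "rescale a e y x \<le> rescale a e z x" if "y \<le> z"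
      by (rule iffD1[OF le], simp only: inv, use that mono_right mono_left LI x y z le in simp)+
    have "L 1 = e"
      by (simp add: L_def)
    then have "T (L x) (L 1) = L x"
      using T_idempotent[OF e LI[OF x]] L[OF x] by simp
    then show "rescale a e x 1 = x"
      by - (rule iffD1[OF eq], simp only: inv)
  qed
  moreover have "continuous_on (\<I> \<times> \<I>) (\<lambda>(x, y). rescale a e x y)"
  proof -
    have "continuous_on (\<I> \<times> \<I>) (\<lambda>p. T (L (fst p)) (L (snd p)))"
    proof (rule continuous_on_T)
      show "continuous_on (\<I> \<times> \<I>) (\<lambda>p. L (fst p))" "continuous_on (\<I> \<times> \<I>) (\<lambda>p. L (snd p))"
        unfolding L_def by (intro continuous_intros)+
    qed (auto simp only: image_subset_iff mem_Times_iff LI fst_conv snd_conv)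
    then have "continuous_on (\<I> \<times> \<I>) (\<lambda>p. (T (L (fst p)) (L (snd p)) - a) / (e - a))"
      using ae by (intro continuous_intros) auto
    then show ?thesis
      by (simp add: rescale_def L_def case_prod_beta)
  qed
  ultimately show ?thesis
    by (simp add: continuous_tnorm_def)
qed

end

context square_injective_t_norm
begin

text \<open>
  Suppose \<open>T u v = T u w\<close> and write \<open>v = T w z\<close>. Multiplication by \<open>z\<close>, hence by every \<open>z\<^sup>n\<close> and by their
  idempotent limit \<open>i\<close>, fixes \<open>T u w\<close>, so \<open>T u w \<le> i\<close>. Were \<open>i \<ge> w\<close>, then \<open>v = T w z \<ge> T w i = w\<close>. So
  \<open>i < w\<close>, and since a gap contains no idempotent, \<open>i \<le> a\<close>. Thus \<open>T u w = a\<close>, and the square of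
  \<open>min u w > a\<close> coincides with the square of \<open>a\<close>.
\<close>

lemma gap_cancel:
  assumes g: "gap a e" and u: "a < u" "u \<le> e" and vw: "a \<le> v" "v < w" "w \<le> e"
  shows "T u v < T u w"
proof -
  note ae = gapD[OF g]
  have I: "u \<in> \<I>" "v \<in> \<I>" "w \<in> \<I>"
    using ae u vw by auto
  have "T u v \<noteq> T u w"
  proof
    assume eq: "T u v = T u w"
    obtain z where z: "z \<in> \<I>" "T w z = v"
      using divides I vw less_imp_le by metis
    have fix_pow: "T (T u w) (pow z n) = T u w" for n
    proof (induction n)
      case (Suc n)
      have "T (T u w) (pow z (Suc n)) = T (T (T u w) (pow z n)) z"
        using I z by (simp only: pow_Suc assoc closed pow_closed)
      also have "\<dots> = T u v"
        using Suc I z by (simp only: assoc)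
      finally show ?case
        using eq by simp
    qed (simp only: tpow_nat.simps unit_right closed I)
    obtain i where i: "idempotent i" "pow z \<longlonglongrightarrow> i" "\<And>n. i \<le> pow z n"
      using pow_limit_idempotent[OF z(1)] by blast
    have iI: "i \<in> \<I>"
      using i by (simp add: idempotent_def)
    have "(\<lambda>n. T (T u w) (pow z n)) \<longlonglongrightarrow> T (T u w) i"
      using i z I by (intro tendsto_T pow_closed tendsto_const closed)
    then have "T (T u w) i = T u w"
      unfolding fix_pow using LIMSEQ_unique tendsto_const by blast
    then have le_i: "T u w \<le> i"
      using le_right[OF closed[OF I(1,3)] iI] by simp
    have "i < w"
    proof (rule ccontr)
      assume "\<not> i < w"
      then have "T w i = w"
        using T_idempotent[OF i(1) I(3)] by simp
      moreover have "T w i \<le> T w z"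
        using i(3)[of 1] I iI z by (intro mono_right) auto
      ultimately show False
        using z vw by simp
    qed
    then have "i \<le> a"
      using g i(1) vw unfolding gap_def by force
    define m where "m = min u w"
    have m: "m \<in> \<I>" "a < m" "m \<le> u" "m \<le> w"
      using I u vw by (auto simp: m_def)
    have "T m m \<le> T u w"
      using m I by (intro mono)
    then have "T m m \<le> a"
      using le_i \<open>i \<le> a\<close> by simp
    moreover have "T a a \<le> T m m"
      using m ae by (intro mono) auto
    moreover have "T a a = a"
      using ae by (simp add: idempotent_def)
    ultimately have "T m m = T a a"
      by simp
    then show False
      using square_injective m ae by blast
  qed
  then show ?thesis
    using mono_right[of u v w] I vw by simp
qed

lemma strict_tnorm_rescale:
  assumes g: "gap a e"
  shows "strict_tnorm (rescale a e)"
  unfolding strict_tnorm_def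
proof (intro conjI ballI impI)
  note ae = gapD[OF g]
  show "continuous_tnorm (rescale a e)"
    using ae by (intro continuous_tnorm_rescale)
  fix x y z :: real
  assume x: "x \<in> \<I>" and y: "y \<in> \<I>" and z: "z \<in> \<I>" and less: "0 < x \<and> y < z"
  have le: "a + (e - a) * t \<le> e" if "t \<in> \<I>" for t
  proof -
    have "(e - a) * t \<le> (e - a) * 1"
      using that ae by (intro mult_left_mono) auto
    then show ?thesis
      by simp
  qed
  have "T (a + (e - a) * x) (a + (e - a) * y) < T (a + (e - a) * x) (a + (e - a) * z)"
    using le[OF x] le[OF z] less ae y by (intro gap_cancel[OF g]) auto
  then show "rescale a e x y < rescale a e x z"
    using ae by (simp add: rescale_def divide_strict_right_mono)
qed

text \<open>
  The summands are the restrictions of \<open>T\<close> to the gaps. Disjoint nonempty open intervals are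
  countably many, so the gaps can be indexed by natural numbers.
\<close>

theorem ordinal_sum_of_strict: "ordinal_sum_of_strict T"
proof -
  define P where "P = {(a, e). gap a e}"
  define I where "I = (\<lambda>(a :: real, e :: real). {a<..<e})"
  have unique: "p = q" if "p \<in> P" "q \<in> P" "I p \<inter> I q \<noteq> {}" for p q
    using that gap_unique by (fastforce simp: P_def I_def)
  have ne: "I p \<noteq> {}" if "p \<in> P" for p
    using that by (auto simp: P_def I_def dest: gapD(6))
  have "countable (I ` P)"
  proof (rule countable_disjoint_open_subsets)
    show "open S" if "S \<in> I ` P" for S
      using that by (auto simp: I_def)
    show "disjoint (I ` P)"
      using unique by (fastforce simp only: pairwise_def disjnt_def image_iff)
  qed
  moreover have "inj_on I P"
    using unique ne by (metis inf.idem inj_onI)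
  ultimately have P: "countable P"
    by (rule countable_image_inj_on)
  define A where "A = to_nat_on P ` P"
  define a where "a i = fst (from_nat_into P i)" for i
  define e where "e i = snd (from_nat_into P i)" for i
  have gap_i: "gap (a i) (e i)" and to_nat: "to_nat_on P (a i, e i) = i" if "i \<in> A" for i
    using that P by (auto simp: A_def a_def e_def P_def)
  have index: "\<exists>i\<in>A. a i = b \<and> e i = c" if "gap b c" for b c
    using that P by (intro bexI[of _ "to_nat_on P (b, c)"]) (auto simp: A_def a_def e_def P_def)
  show ?thesis
    unfolding ordinal_sum_of_strict_def
  proof (rule exI[of _ A], rule exI[of _ "\<lambda>i. rescale (a i) (e i)"], rule exI[of _ a], rule exI[of _ e],
      intro conjI ballI impI)
    show "strict_tnorm (rescale (a i) (e i))" if "i \<in> A" for i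
      using strict_tnorm_rescale gap_i that .
    show "0 \<le> a i" if "i \<in> A" for i
      using gapD(5)[OF gap_i[OF that]] .
    show "a i < e i" if "i \<in> A" for i
      using gapD(6)[OF gap_i[OF that]] .
    show "e i \<le> 1" if "i \<in> A" for i
      using gapD(7)[OF gap_i[OF that]] .
    show "disjoint_family_on (\<lambda>i. {a i<..<e i}) A"
      unfolding disjoint_family_on_def
    proof (intro ballI impI)
      fix i j assume ij: "i \<in> A" "j \<in> A" "i \<noteq> j"
      then have "(a i, e i) \<in> P" "(a j, e j) \<in> P" "(a i, e i) \<noteq> (a j, e j)"
        using gap_i to_nat by (auto simp: P_def) metis
      then have "I (a i, e i) \<inter> I (a j, e j) = {}"
        using unique by blast
      then show "{a i<..<e i} \<inter> {a j<..<e j} = {}"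
        by (simp add: I_def)
    qed
    show "T u v = a i + (e i - a i) * rescale (a i) (e i) ((u - a i) / (e i - a i)) ((v - a i) / (e i - a i))"
      if "i \<in> A" for u v i
      using T_eq_rescale[OF gapD(6)[OF gap_i[OF that]]] .
    show "T u v = min u v"
      if "u \<in> \<I>" "v \<in> \<I>" "\<nexists>i. i \<in> A \<and> u \<in> {a i..e i} \<and> v \<in> {a i..e i}" for u v
      using that index by (intro T_eq_min_outside_gaps) blast+
  qed
qed

end


section \<open>Ordinal sums of strict t-norms\<close>

context continuous_t_norm
begin

lemma square_strict_mono_imp_square_injective:
  assumes "\<And>x y. x \<in> \<I> \<Longrightarrow> y \<in> \<I> \<Longrightarrow> x < y \<Longrightarrow> T x x < T y y"
  shows "square_injective_t_norm T"
proof
  show "x = y" if "x \<in> \<I>" "y \<in> \<I>" "T x x = T y y" for x y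
    using assms[OF that(1,2)] assms[OF that(2,1)] that(3) by linarith
qed

end

lemma strict_tnorm_square_strict_mono:
  assumes S: "strict_tnorm S" and x: "x \<in> \<I>" and y: "y \<in> \<I>" and "x < y"
  shows "S x x < S y y"
proof -
  interpret S: continuous_t_norm S
    using S by unfold_locales (simp add: strict_tnorm_def)
  have "S x x \<le> S y x"
    using x y \<open>x < y\<close> by (intro S.mono_left) auto
  also have "\<dots> < S y y"
    using S x y \<open>x < y\<close> by (auto simp: strict_tnorm_def)
  finally show ?thesis .
qed

context continuous_t_norm
begin

text \<open>
  The square of \<open>y\<close> stays in every summand interval that contains \<open>y\<close>. So either \<open>x < y\<close> lie in a common
  interval and strictness of the summand applies, or an endpoint of an interval, or \<open>y\<close> itself,
  separates the two squares.
\<close>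

lemma ordinal_sum_imp_square_injective:
  assumes "ordinal_sum_of_strict T"
  shows "square_injective_t_norm T"
proof (rule square_strict_mono_imp_square_injective)
  fix x y assume x: "x \<in> \<I>" and y: "y \<in> \<I>" and less: "x < y"
  obtain A S a e where
    S: "\<And>i. i \<in> A \<Longrightarrow> strict_tnorm (S i)" and
    ae: "\<And>i. i \<in> (A :: nat set) \<Longrightarrow> 0 \<le> a i \<and> a i < e i \<and> e i \<le> 1" and
    inside: "\<And>u i. u \<in> \<I> \<Longrightarrow> i \<in> A \<Longrightarrow> u \<in> {a i..e i} \<Longrightarrow>
      T u u = a i + (e i - a i) * S i ((u - a i) / (e i - a i)) ((u - a i) / (e i - a i))" and
    outside: "\<And>u. u \<in> \<I> \<Longrightarrow> (\<And>i. i \<in> A \<Longrightarrow> u \<notin> {a i..e i}) \<Longrightarrow> T u u = u"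
    using assms unfolding ordinal_sum_of_strict_def by (smt (verit, best) min.idem)
  have scaled: "(u - a i) / (e i - a i) \<in> \<I>" if "i \<in> A" "u \<in> {a i..e i}" for i u
    using ae[OF that(1)] that(2) by (auto simp: divide_le_eq)
  show "T x x < T y y"
  proof (cases "\<exists>i\<in>A. y \<in> {a i..e i}")
    case True
    then obtain i where i: "i \<in> A" "y \<in> {a i..e i}"
      by blast
    interpret S: continuous_t_norm "S i"
      using S[OF i(1)] by unfold_locales (simp add: strict_tnorm_def)
    note aei = ae[OF i(1)]
    show ?thesis
    proof (cases "a i \<le> x")
      case True
      then have xi: "x \<in> {a i..e i}"
        using less i by auto
      have "(x - a i) / (e i - a i) < (y - a i) / (e i - a i)"
        using less aei by (intro divide_strict_right_mono) auto
      then have "S i ((x - a i) / (e i - a i)) ((x - a i) / (e i - a i))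
          < S i ((y - a i) / (e i - a i)) ((y - a i) / (e i - a i))"
        by (rule strict_tnorm_square_strict_mono[OF S[OF i(1)] scaled[OF i(1) xi] scaled[OF i]])
      then show ?thesis
        using inside[OF x i(1) xi] inside[OF y i] aei by simp
    next
      case False
      have "0 \<le> S i ((y - a i) / (e i - a i)) ((y - a i) / (e i - a i))"
        using S.closed scaled[OF i] by (meson atLeastAtMost_iff)
      then have "a i \<le> T y y"
        using inside[OF y i] aei by simp
      then show ?thesis
        using False le_left[OF x x] by simp
    qed
  next
    case False
    then show ?thesis
      using outside[OF y] le_left[OF x x] less by auto
  qed
qed

end

theorem theorem6:
  fixes T :: "real \<Rightarrow> real \<Rightarrow> real"
  assumes "continuous_tnorm T"
  shows "(power_stable T \<longleftrightarrow> (\<forall>u\<in>{0..1}. power_stable_element T u)) \<and>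
         ((\<forall>u\<in>{0..1}. power_stable_element T u) \<longleftrightarrow>
            (\<forall>u\<in>{0..1}. \<forall>v\<in>{0..1}. T u v = min u v) \<or>
            strict_tnorm T \<or>
            ordinal_sum_of_strict T)"
proof -
  interpret continuous_t_norm T
    using assms by unfold_locales
  have i: "power_stable T \<longleftrightarrow> square_injective_t_norm T"
    using power_stable_imp_square_injective square_injective_t_norm.power_stable by blast
  have ii: "(\<forall>u\<in>\<I>. power_stable_element T u) \<longleftrightarrow> square_injective_t_norm T"
    using power_stable_elements_imp_square_injective square_injective_t_norm.power_stable_element by blast
  have "square_injective_t_norm T" if "\<forall>u\<in>\<I>. \<forall>v\<in>\<I>. T u v = min u v"
    using that by (intro square_strict_mono_imp_square_injective) simp
  moreover have "square_injective_t_norm T" if "strict_tnorm T"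
    using that strict_tnorm_square_strict_mono by (intro square_strict_mono_imp_square_injective)
  moreover have "square_injective_t_norm T \<longleftrightarrow> ordinal_sum_of_strict T"
    using ordinal_sum_imp_square_injective square_injective_t_norm.ordinal_sum_of_strict by blast
  ultimately have iii: "square_injective_t_norm T \<longleftrightarrow>
      (\<forall>u\<in>\<I>. \<forall>v\<in>\<I>. T u v = min u v) \<or> strict_tnorm T \<or> ordinal_sum_of_strict T"
    by blast
  show ?thesis
    using i ii iii by blast
qed

end
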